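(* Let $\mathbf{B}$ be a category and let $\mathbf{C},\mathbf{D},\mathbf{R}^\natural,\mathbf{R}^\sharp$ be concrete categories over $\mathbf{B}$. Let $\gamma_D:\mathbf{D}\to\mathbf{C}$ be a concrete functor with a weak left adjoint $\langle\alpha,\eta\rangle$, and let $F^\natural:\mathbf{C}\to\mathbf{R}^\natural$, $F^\sharp:\mathbf{D}\to\mathbf{R}^\sharp$ and $\gamma_R:\mathbf{R}^\sharp\to\mathbf{R}^\natural$ be concrete functors. Suppose that $F^\sharp$ is sound with respect to $F^\natural\circ\gamma_D$, i.e. $F^\natural(\gamma_D(P))\preceq\gamma_R(F^\sharp(P))$ for every object $P$ of $\mathbf{D}$. Suppose further that $\mathbf{R}^\sharp$ is fibred and that $\gamma_R$ is a cartesian functor. Let $\overline{F}^\sharp:\mathbf{C}\to\mathbf{R}^\sharp$ be the lifting of $F^\sharp$, $\overline{F}^\sharp(A):=\eta_A^{-1}(F^\sharp(\alpha(A)))$. Then $\overline{F}^\sharp$ is sound with respect to $F^\natural$, i.e. $F^\natural(A)\preceq\gamma_R(\overline{F}^\sharp(A))$ for every object $A$ of $\mathbf{C}$.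
   Context: A concrete category over a category $\mathbf{B}$ is a category $\mathbf{C}$ together with a faithful functor $\phi_{\mathbf{C}}:\mathbf{C}\to\mathbf{B}$. For objects $A,B$ of $\mathbf{C}$ and $f\in\mathbf{B}(\phi_{\mathbf{C}}(A),\phi_{\mathbf{C}}(B))$, write $A\Vdash_f B$ if there is an arrow $g\in\mathbf{C}(A,B)$ with $\phi_{\mathbf{C}}(g)=f$. A functor $F:\mathbf{C}\to\mathbf{D}$ between concrete categories over $\mathbf{B}$ is concrete if $\phi_{\mathbf{C}}=\phi_{\mathbf{D}}\circ F$. For objects $C,C'$ of a concrete category $\mathbf{C}$, write $C\preceq C'$ if $\phi_{\mathbf{C}}(C)=\phi_{\mathbf{C}}(C')$ and $C\Vdash_{1}C'$ where $1$ is the identity of $\phi_{\mathbf{C}}(C)$. Weak left adjoint: for a concrete functor $\gamma:\mathbf{D}\to\mathbf{C}$, a weak left adjoint of $\gamma$ is a pair $\langle\alpha,\eta\rangle$ where $\alpha$ assigns to every object $A$ of $\mathbf{C}$ an object $\alpha(A)$ of $\mathbf{D}$ ($\alpha$ need not be a functor), and $\eta$ assigns to every object $A$ of $\mathbf{C}$ an arrow $\eta_A\in\mathbf{B}(\phi_{\mathbf{C}}(A),\phi_{\mathbf{D}}(\alpha(A)))$, such that (1) $A\Vdash_{\eta_A}\gamma(\alpha(A))$, and (2) for every object $K$ of $\mathbf{D}$ and every $f\in\mathbf{B}(\phi_{\mathbf{C}}(A),\phi_{\mathbf{D}}(K))$ with $A\Vdash_f\gamma(K)$, there is an arrow $\overline{f}\in\mathbf{B}(\phi_{\mathbf{D}}(\alpha(A)),\phi_{\mathbf{D}}(K))$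 (not necessarily unique) with $\alpha(A)\Vdash_{\overline{f}}K$ and $f=\overline{f}\circ\eta_A$. Cartesian arrows: let $\mathbf{C}$ be concrete over $\mathbf{B}$, $B$ an object of $\mathbf{C}$, and $f:X\to\phi_{\mathbf{C}}(B)$ an arrow of $\mathbf{B}$. An arrow $u\in\mathbf{C}(A,B)$ is cartesian (for $f$ and $B$) if $\phi_{\mathbf{C}}(A)=X$, $\phi_{\mathbf{C}}(u)=f$, and for every object $Z$ of $\mathbf{C}$ and every arrow $h:\phi_{\mathbf{C}}(Z)\to X$ of $\mathbf{B}$ with $Z\Vdash_{f\circ h}B$, we have $Z\Vdash_h A$. A concrete category $\mathbf{C}$ is fibred if every object $B$ and every arrow $f:X\to\phi_{\mathbf{C}}(B)$ of $\mathbf{B}$ has a cartesian arrow, and compositions of cartesian arrows are cartesian. For a fibred category a canonical choice of cartesian arrow for each $f$ and $B$ is fixed, and its domain is denoted $f^{-1}(B)$. A concrete functor is cartesian if it sends cartesian arrows to cartesian arrows. *)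

theory Defs
  imports Main
begin

record ('o, 'a) cat =
  Obj :: "'o set"
  Arr :: "'a set"
  Dom :: "'a \<Rightarrow> 'o"
  Cod :: "'a \<Rightarrow> 'o"
  Idn :: "'o \<Rightarrow> 'a"
  Cmp :: "'a \<Rightarrow> 'a \<Rightarrow> 'a"

definition Hom :: "('o, 'a, 'z) cat_scheme \<Rightarrow> 'o \<Rightarrow> 'o \<Rightarrow> 'a set" where
  "Hom C A B = {f \<in> Arr C. Dom C f = A \<and> Cod C f = B}"

text \<open>\<^term>\<open>Cmp C g f\<close> is \<open>g \<circ> f\<close> (first \<open>f\<close>, then \<open>g\<close>); its value is unspecified
  when \<open>f\<close> and \<open>g\<close> are not composable arrows of \<open>C\<close>.\<close>

locale category =
  fixes C :: "('o, 'a, 'z) cat_scheme"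
  assumes Dom_closed: "f \<in> Arr C \<Longrightarrow> Dom C f \<in> Obj C"
    and Cod_closed: "f \<in> Arr C \<Longrightarrow> Cod C f \<in> Obj C"
    and Idn_Hom: "A \<in> Obj C \<Longrightarrow> Idn C A \<in> Hom C A A"
    and Cmp_Hom: "f \<in> Hom C A B \<Longrightarrow> g \<in> Hom C B E \<Longrightarrow> Cmp C g f \<in> Hom C A E"
    and Cmp_Idn_left: "f \<in> Hom C A B \<Longrightarrow> Cmp C (Idn C B) f = f"
    and Cmp_Idn_right: "f \<in> Hom C A B \<Longrightarrow> Cmp C f (Idn C A) = f"
    and Cmp_assoc: "f \<in> Hom C A B \<Longrightarrow> g \<in> Hom C B E \<Longrightarrow> h \<in> Hom C E G \<Longrightarrow>
      Cmp C h (Cmp C g f) = Cmp C (Cmp C h g) f"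

record ('o, 'a, 'p, 'b) functor_data =
  FObj :: "'o \<Rightarrow> 'p"
  FArr :: "'a \<Rightarrow> 'b"

locale cat_functor = dom: category C + cod: category D
  for C :: "('o, 'a, 'y) cat_scheme" and D :: "('p, 'b, 'z) cat_scheme" +
  fixes F :: "('o, 'a, 'p, 'b) functor_data"
  assumes FObj_closed: "A \<in> Obj C \<Longrightarrow> FObj F A \<in> Obj D"
    and FArr_Hom: "f \<in> Hom C A B \<Longrightarrow> FArr F f \<in> Hom D (FObj F A) (FObj F B)"
    and FArr_Idn: "A \<in> Obj C \<Longrightarrow> FArr F (Idn C A) = Idn D (FObj F A)"
    and FArr_Cmp: "f \<in> Hom C A B \<Longrightarrow> g \<in> Hom C B E \<Longrightarrow>
      FArr F (Cmp C g f) = Cmp D (FArr F g) (FArr F f)"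

definition functor_comp ::
  "('p, 'b, 'q, 'c) functor_data \<Rightarrow> ('o, 'a, 'p, 'b) functor_data \<Rightarrow> ('o, 'a, 'q, 'c) functor_data"
  where "functor_comp G F = \<lparr>FObj = FObj G \<circ> FObj F, FArr = FArr G \<circ> FArr F\<rparr>"

text \<open>A category bundled with its functor \<open>\<phi>\<close> to the base category.\<close>

record ('o, 'a, 'p, 'b) ccat = "('o, 'a) cat" +
  Forg :: "('o, 'a, 'p, 'b) functor_data"

abbreviation phiO :: "('o, 'a, 'p, 'b, 'z) ccat_scheme \<Rightarrow> 'o \<Rightarrow> 'p"
  where "phiO C \<equiv> FObj (Forg C)"

abbreviation phiA :: "('o, 'a, 'p, 'b, 'z) ccat_scheme \<Rightarrow> 'a \<Rightarrow> 'b"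
  where "phiA C \<equiv> FArr (Forg C)"

locale concrete_category = cat_functor C B "Forg C"
  for B :: "('p, 'b, 'y) cat_scheme" and C :: "('o, 'a, 'p, 'b, 'z) ccat_scheme" +
  assumes faithful: "f \<in> Hom C A A' \<Longrightarrow> g \<in> Hom C A A' \<Longrightarrow> phiA C f = phiA C g \<Longrightarrow> f = g"

definition forces :: "('o, 'a, 'p, 'b, 'z) ccat_scheme \<Rightarrow> 'o \<Rightarrow> 'b \<Rightarrow> 'o \<Rightarrow> bool" where
  "forces C A f A' \<longleftrightarrow> (\<exists>g \<in> Hom C A A'. phiA C g = f)"

definition preceq ::
  "('p, 'b, 'y) cat_scheme \<Rightarrow> ('o, 'a, 'p, 'b, 'z) ccat_scheme \<Rightarrow> 'o \<Rightarrow> 'o \<Rightarrow> bool" where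
  "preceq B C A A' \<longleftrightarrow> phiO C A = phiO C A' \<and> forces C A (Idn B (phiO C A)) A'"

text \<open>The equation \<open>\<phi>\<^sub>C = \<phi>\<^sub>D \<circ> F\<close> is imposed on the objects and arrows of \<open>C\<close> only, as the
  underlying HOL functions are unconstrained elsewhere.\<close>

locale concrete_functor =
  src: concrete_category B C + tgt: concrete_category B D + cat_functor C D F
  for B :: "('p, 'b, 'y) cat_scheme"
    and C :: "('o1, 'a1, 'p, 'b, 'z1) ccat_scheme"
    and D :: "('o2, 'a2, 'p, 'b, 'z2) ccat_scheme"
    and F :: "('o1, 'a1, 'o2, 'a2) functor_data" +
  assumes phiO_F: "A \<in> Obj C \<Longrightarrow> phiO D (FObj F A) = phiO C A"
    and phiA_F: "f \<in> Arr C \<Longrightarrow> phiA D (FArr F f) = phiA C f"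

locale weak_left_adjoint = concrete_functor B D C \<gamma>
  for B :: "('p, 'b, 'y) cat_scheme"
    and C :: "('o1, 'a1, 'p, 'b, 'z1) ccat_scheme"
    and D :: "('o2, 'a2, 'p, 'b, 'z2) ccat_scheme"
    and \<gamma> :: "('o2, 'a2, 'o1, 'a1) functor_data" +
  fixes \<alpha> :: "'o1 \<Rightarrow> 'o2" and \<eta> :: "'o1 \<Rightarrow> 'b"
  assumes alpha_closed: "A \<in> Obj C \<Longrightarrow> \<alpha> A \<in> Obj D"
    and eta_Hom: "A \<in> Obj C \<Longrightarrow> \<eta> A \<in> Hom B (phiO C A) (phiO D (\<alpha> A))"
    and unit: "A \<in> Obj C \<Longrightarrow> forces C A (\<eta> A) (FObj \<gamma> (\<alpha> A))"
    and extension: "A \<in> Obj C \<Longrightarrow> K \<in> Obj D \<Longrightarrow> f \<in> Hom B (phiO C A) (phiO D K) \<Longrightarrow>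
      forces C A f (FObj \<gamma> K) \<Longrightarrow>
      \<exists>f' \<in> Hom B (phiO D (\<alpha> A)) (phiO D K). forces D (\<alpha> A) f' K \<and> f = Cmp B f' (\<eta> A)"

definition cartesian_arrow ::
  "('p, 'b, 'y) cat_scheme \<Rightarrow> ('o, 'a, 'p, 'b, 'z) ccat_scheme \<Rightarrow> 'b \<Rightarrow> 'o \<Rightarrow> 'a \<Rightarrow> bool" where
  "cartesian_arrow B C f E u \<longleftrightarrow>
     u \<in> Arr C \<and> Cod C u = E \<and> phiO C (Dom C u) = Dom B f \<and> phiA C u = f \<and>
     (\<forall>Z \<in> Obj C. \<forall>h \<in> Hom B (phiO C Z) (Dom B f).
        forces C Z (Cmp B f h) E \<longrightarrow> forces C Z h (Dom C u))"

abbreviation is_cartesian ::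
  "('p, 'b, 'y) cat_scheme \<Rightarrow> ('o, 'a, 'p, 'b, 'z) ccat_scheme \<Rightarrow> 'a \<Rightarrow> bool" where
  "is_cartesian B C u \<equiv> cartesian_arrow B C (phiA C u) (Cod C u) u"

locale fibred_category = concrete_category B C
  for B :: "('p, 'b, 'y) cat_scheme" and C :: "('o, 'a, 'p, 'b, 'z) ccat_scheme" +
  assumes cartesian_exists:
      "E \<in> Obj C \<Longrightarrow> f \<in> Arr B \<Longrightarrow> Cod B f = phiO C E \<Longrightarrow> \<exists>u. cartesian_arrow B C f E u"
    and cartesian_Cmp:
      "u \<in> Hom C A E \<Longrightarrow> v \<in> Hom C E G \<Longrightarrow> is_cartesian B C u \<Longrightarrow> is_cartesian B C v \<Longrightarrow>
       is_cartesian B C (Cmp C v u)"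

text \<open>A fibred category with a fixed choice of cartesian arrows: \<^term>\<open>\<kappa> f E\<close> is the chosen
  cartesian arrow for \<open>f\<close> and \<open>E\<close>, and its domain is \<open>f\<^sup>-\<^sup>1(E)\<close>.\<close>

locale cloven_fibred_category = fibred_category B C
  for B :: "('p, 'b, 'y) cat_scheme" and C :: "('o, 'a, 'p, 'b, 'z) ccat_scheme" +
  fixes \<kappa> :: "'b \<Rightarrow> 'o \<Rightarrow> 'a"
  assumes choice_cartesian:
    "E \<in> Obj C \<Longrightarrow> f \<in> Arr B \<Longrightarrow> Cod B f = phiO C E \<Longrightarrow> cartesian_arrow B C f E (\<kappa> f E)"

definition inverse_image ::
  "('o, 'a, 'p, 'b, 'z) ccat_scheme \<Rightarrow> ('b \<Rightarrow> 'o \<Rightarrow> 'a) \<Rightarrow> 'b \<Rightarrow> 'o \<Rightarrow> 'o" where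
  "inverse_image C \<kappa> f E = Dom C (\<kappa> f E)"

locale cartesian_functor = concrete_functor B C D F
  for B :: "('p, 'b, 'y) cat_scheme"
    and C :: "('o1, 'a1, 'p, 'b, 'z1) ccat_scheme"
    and D :: "('o2, 'a2, 'p, 'b, 'z2) ccat_scheme"
    and F :: "('o1, 'a1, 'o2, 'a2) functor_data" +
  assumes preserves_cartesian: "is_cartesian B C u \<Longrightarrow> is_cartesian B D (FArr F u)"

definition sound ::
  "('p, 'b, 'y) cat_scheme \<Rightarrow> ('o, 'a, 'w) cat_scheme \<Rightarrow> ('o1, 'a1, 'p, 'b, 'z) ccat_scheme \<Rightarrow>
   ('o2, 'a2, 'o1, 'a1) functor_data \<Rightarrow> ('o, 'a, 'o2, 'a2) functor_data \<Rightarrow>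
   ('o, 'a, 'o1, 'a1) functor_data \<Rightarrow> bool" where
  "sound B D R \<gamma> G F \<longleftrightarrow> (\<forall>P \<in> Obj D. preceq B R (FObj F P) (FObj \<gamma> (FObj G P)))"

text \<open>The lifting of \<open>F\<close> sends \<open>A\<close> to \<open>\<eta>\<^sub>A\<^sup>-\<^sup>1(F(\<alpha>(A)))\<close>. Its action on an arrow \<open>g\<close> is forced by
  faithfulness: it is the only arrow over \<open>\<phi>(g)\<close> between the given objects. That such an arrow
  exists is part of \<open>lifting_concrete_functor\<close> below.\<close>

definition lifting ::
  "('o1, 'a1, 'p, 'b, 'y) ccat_scheme \<Rightarrow> ('o3, 'a3, 'p, 'b, 'z) ccat_scheme \<Rightarrow>
   ('b \<Rightarrow> 'o3 \<Rightarrow> 'a3) \<Rightarrow> ('o1 \<Rightarrow> 'o2) \<Rightarrow> ('o1 \<Rightarrow> 'b) \<Rightarrow> ('o2, 'a2, 'o3, 'a3) functor_data \<Rightarrow>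
   ('o1, 'a1, 'o3, 'a3) functor_data" where
  "lifting C R \<kappa> \<alpha> \<eta> F =
     (let L = (\<lambda>A. inverse_image R \<kappa> (\<eta> A) (FObj F (\<alpha> A)))
      in \<lparr>FObj = L,
          FArr = (\<lambda>g. THE u. u \<in> Hom R (L (Dom C g)) (L (Cod C g)) \<and> phiA R u = phiA C g)\<rparr>)"

lemma FObj_lifting: "FObj (lifting C R \<kappa> \<alpha> \<eta> F) A = inverse_image R \<kappa> (\<eta> A) (FObj F (\<alpha> A))"
  by (simp add: lifting_def)

lemma (in category) Hom_Obj: "f \<in> Hom C A A' \<Longrightarrow> A \<in> Obj C \<and> A' \<in> Obj C"
  using Dom_closed Cod_closed by (auto simp: Hom_def)

lemma (in concrete_category) forces_Cmp:
  assumes "forces C A f A'" and "forces C A' g A''"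
  shows "forces C A (Cmp B g f) A''"
  using assms FArr_Cmp dom.Cmp_Hom unfolding forces_def by metis

lemma (in concrete_functor) forces_image:
  assumes "forces C A f A'"
  shows "forces D (FObj F A) f (FObj F A')"
proof -
  obtain g where "g \<in> Hom C A A'" "phiA C g = f" using assms by (auto simp: forces_def)
  then have "FArr F g \<in> Hom D (FObj F A) (FObj F A')" "phiA D (FArr F g) = f"
    using FArr_Hom phiA_F by (auto simp: Hom_def)
  then show ?thesis by (auto simp: forces_def)
qed

lemma lifting_concrete_functor:
  assumes "weak_left_adjoint B C D \<gamma> \<alpha> \<eta>"
    and "concrete_functor B D R F"
    and "cloven_fibred_category B R \<kappa>"
  shows "concrete_functor B C R (lifting C R \<kappa> \<alpha> \<eta> F)"
proof -
  interpret R: cloven_fibred_category B R \<kappa> by fact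
  interpret W: weak_left_adjoint B C D \<gamma> \<alpha> \<eta> by fact
  interpret F: concrete_functor B D R F by fact
  define L where "L = (\<lambda>A. inverse_image R \<kappa> (\<eta> A) (FObj F (\<alpha> A)))"
  let ?L = "lifting C R \<kappa> \<alpha> \<eta> F"
  have LO: "FObj ?L = L" by (auto simp: FObj_lifting L_def)
  have cart: "cartesian_arrow B R (\<eta> A) (FObj F (\<alpha> A)) (\<kappa> (\<eta> A) (FObj F (\<alpha> A)))"
    if "A \<in> Obj C" for A
    by (rule R.choice_cartesian)
      (use that W.alpha_closed W.eta_Hom F.FObj_closed F.phiO_F in \<open>auto simp: Hom_def\<close>)
  have L_Obj: "L A \<in> Obj R" if "A \<in> Obj C" for A
    using cart[OF that] R.dom.Dom_closed
    by (auto simp: cartesian_arrow_def L_def inverse_image_def)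
  have eta_Dom: "Dom B (\<eta> A) = phiO C A" if "A \<in> Obj C" for A
    using W.eta_Hom[OF that] by (auto simp: Hom_def)
  have phi_L: "phiO R (L A) = phiO C A" if "A \<in> Obj C" for A
    using cart[OF that] eta_Dom[OF that]
    by (auto simp: cartesian_arrow_def L_def inverse_image_def)
  have L_forces: "forces R (L A) (\<eta> A) (FObj F (\<alpha> A))" if "A \<in> Obj C" for A
    using cart[OF that]
    by (auto simp: cartesian_arrow_def L_def inverse_image_def forces_def Hom_def)
  have univ: "forces R Z h (L A)"
    if "A \<in> Obj C" "Z \<in> Obj R" "h \<in> Hom B (phiO R Z) (phiO C A)"
      "forces R Z (Cmp B (\<eta> A) h) (FObj F (\<alpha> A))" for A Z h
    using cart[OF that(1)] that eta_Dom[OF that(1)]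
    by (auto simp: cartesian_arrow_def L_def inverse_image_def)
  have arr: "forces R (L A) (phiA C g) (L A')" if g: "g \<in> Hom C A A'" for g A A'
  proof -
    have O: "A \<in> Obj C" "A' \<in> Obj C" using W.tgt.dom.Hom_Obj[OF g] by auto
    have pg: "phiA C g \<in> Hom B (phiO C A) (phiO C A')" by (rule W.tgt.FArr_Hom[OF g])
    have "forces C A (phiA C g) A'" using g by (auto simp: forces_def)
    then have fg: "forces C A (Cmp B (\<eta> A') (phiA C g)) (FObj \<gamma> (\<alpha> A'))"
      using W.tgt.forces_Cmp W.unit O by blast
    obtain f' where f': "forces D (\<alpha> A) f' (\<alpha> A')" "Cmp B (\<eta> A') (phiA C g) = Cmp B f' (\<eta> A)"
      using W.extension[OF O(1) W.alpha_closed[OF O(2)] _ fg]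
        R.cod.Cmp_Hom[OF pg W.eta_Hom[OF O(2)]] by blast
    have "forces R (L A) (Cmp B f' (\<eta> A)) (FObj F (\<alpha> A'))"
      using R.forces_Cmp[OF L_forces[OF O(1)] F.forces_image[OF f'(1)]] .
    then show ?thesis
      using univ[OF O(2) L_Obj[OF O(1)]] pg phi_L[OF O(1)] f'(2) by simp
  qed
  have LA: "FArr ?L g \<in> Hom R (L A) (L A') \<and> phiA R (FArr ?L g) = phiA C g"
    if g: "g \<in> Hom C A A'" for g A A'
  proof -
    obtain u where u: "u \<in> Hom R (L A) (L A')" "phiA R u = phiA C g"
      using arr[OF g] by (auto simp: forces_def)
    have "FArr ?L g = (THE u. u \<in> Hom R (L A) (L A') \<and> phiA R u = phiA C g)"
      using g by (simp add: lifting_def L_def Hom_def)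
    also have "\<dots> = u"
      by (rule the_equality) (use u R.faithful in auto)
    finally show ?thesis using u by simp
  qed
  show ?thesis
  proof
    show "FObj ?L A \<in> Obj R" if "A \<in> Obj C" for A
      using L_Obj that by (simp add: LO)
    show "FArr ?L f \<in> Hom R (FObj ?L A) (FObj ?L A')" if "f \<in> Hom C A A'" for f A A'
      using LA that by (simp add: LO)
    show "FArr ?L (Idn C A) = Idn R (FObj ?L A)" if A: "A \<in> Obj C" for A
    proof (rule R.faithful)
      show "FArr ?L (Idn C A) \<in> Hom R (L A) (L A)"
        using LA[OF W.tgt.dom.Idn_Hom[OF A]] by simp
      show "Idn R (FObj ?L A) \<in> Hom R (L A) (L A)"
        using R.dom.Idn_Hom L_Obj[OF A] by (simp add: LO)
      show "phiA R (FArr ?L (Idn C A)) = phiA R (Idn R (FObj ?L A))"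
        using LA[OF W.tgt.dom.Idn_Hom[OF A]] W.tgt.FArr_Idn[OF A]
          R.FArr_Idn[OF L_Obj[OF A]] phi_L[OF A] by (simp add: LO)
    qed
    show "FArr ?L (Cmp C g f) = Cmp R (FArr ?L g) (FArr ?L f)"
      if f: "f \<in> Hom C A A'" and g: "g \<in> Hom C A' E" for f g A A' E
    proof (rule R.faithful)
      note c = W.tgt.dom.Cmp_Hom[OF f g]
      show "FArr ?L (Cmp C g f) \<in> Hom R (L A) (L E)" using LA[OF c] by simp
      show "Cmp R (FArr ?L g) (FArr ?L f) \<in> Hom R (L A) (L E)"
        using R.dom.Cmp_Hom LA[OF f] LA[OF g] by blast
      show "phiA R (FArr ?L (Cmp C g f)) = phiA R (Cmp R (FArr ?L g) (FArr ?L f))"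
        using R.FArr_Cmp[OF conjunct1[OF LA[OF f]] conjunct1[OF LA[OF g]]]
          W.tgt.FArr_Cmp[OF f g] LA[OF c] LA[OF f] LA[OF g] by simp
    qed
    show "phiO R (FObj ?L A) = phiO C A" if "A \<in> Obj C" for A
      using phi_L that by (simp add: LO)
    show "phiA R (FArr ?L f) = phiA C f" if "f \<in> Arr C" for f
      using LA[of f "Dom C f" "Cod C f"] that by (simp add: Hom_def)
  qed
qed

end

theory Submission
  imports Defs
begin

text \<open>Soundness of \<open>F\<^sup>\<sharp>\<close> at \<open>\<alpha>(A)\<close>, composed with the image under \<open>F\<^sup>\<natural>\<close> of the unit at \<open>A\<close>, gives
  an arrow \<open>F\<^sup>\<natural>(A) \<rightarrow> \<gamma>\<^sub>R(F\<^sup>\<sharp>(\<alpha>(A)))\<close> over \<open>\<eta>\<^sub>A\<close>. As \<open>\<gamma>\<^sub>R\<close> preserves the cartesian arrow defining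
  the inverse image, this arrow factors through it over the identity.\<close>

text \<open>\<open>is_cartesian\<close> reads base arrow and codomain off the arrow itself;
  concreteness of \<open>F\<close> ensures that the image still lies over the same
  \<open>f\<close>.\<close>

lemma (in cartesian_functor) cartesian_arrow_image:
  assumes "cartesian_arrow B C f E u"
  shows "cartesian_arrow B D f (FObj F E) (FArr F u)"
    and "Dom D (FArr F u) = FObj F (Dom C u)"
proof -
  have u: "u \<in> Hom C (Dom C u) E" "phiA C u = f" "Cod C u = E" "u \<in> Arr C"
    using assms by (auto simp: cartesian_arrow_def Hom_def)
  have "FArr F u \<in> Hom D (FObj F (Dom C u)) (FObj F E)"
    using FArr_Hom[OF u(1)] .
  then show "Dom D (FArr F u) = FObj F (Dom C u)"
    and "cartesian_arrow B D f (FObj F E) (FArr F u)"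
    using preserves_cartesian[of u] assms u phiA_F[of u] by (auto simp: Hom_def)
qed

theorem theorem2:
  fixes B :: "('p, 'b) cat"
    and C :: "('oc, 'ac, 'p, 'b) ccat"
    and D :: "('od, 'ad, 'p, 'b) ccat"
    and Rn :: "('on, 'an, 'p, 'b) ccat"
    and Rs :: "('os, 'as, 'p, 'b) ccat"
    and \<gamma>D :: "('od, 'ad, 'oc, 'ac) functor_data"
    and \<alpha> :: "'oc \<Rightarrow> 'od"
    and \<eta> :: "'oc \<Rightarrow> 'b"
    and Fn :: "('oc, 'ac, 'on, 'an) functor_data"
    and Fs :: "('od, 'ad, 'os, 'as) functor_data"
    and \<gamma>R :: "('os, 'as, 'on, 'an) functor_data"
    and \<kappa> :: "'b \<Rightarrow> 'os \<Rightarrow> 'as"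
  assumes "category B"
    and "concrete_category B C"
    and "concrete_category B D"
    and "concrete_category B Rn"
    and "concrete_category B Rs"
    and "concrete_functor B D C \<gamma>D"
    and "weak_left_adjoint B C D \<gamma>D \<alpha> \<eta>"
    and "concrete_functor B C Rn Fn"
    and "concrete_functor B D Rs Fs"
    and "concrete_functor B Rs Rn \<gamma>R"
    and "sound B D Rn \<gamma>R Fs (functor_comp Fn \<gamma>D)"
    and "cloven_fibred_category B Rs \<kappa>"
    and "cartesian_functor B Rs Rn \<gamma>R"
  shows "sound B C Rn \<gamma>R (lifting C Rs \<kappa> \<alpha> \<eta> Fs) Fn"
proof -
  interpret Rs: cloven_fibred_category B Rs \<kappa> by fact
  interpret W: weak_left_adjoint B C D \<gamma>D \<alpha> \<eta> by fact
  interpret Fn: concrete_functor B C Rn Fn by fact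
  interpret Fs: concrete_functor B D Rs Fs by fact
  interpret R: cartesian_functor B Rs Rn \<gamma>R by fact
  have "preceq B Rn (FObj Fn A) (FObj \<gamma>R (inverse_image Rs \<kappa> (\<eta> A) (FObj Fs (\<alpha> A))))"
    if A: "A \<in> Obj C" for A
  proof -
    let ?E = "FObj Fs (\<alpha> A)"
    let ?u = "\<kappa> (\<eta> A) ?E"
    note \<alpha>A = W.alpha_closed[OF A] and \<eta>A = W.eta_Hom[OF A]
    have FnA: "FObj Fn A \<in> Obj Rn" "phiO Rn (FObj Fn A) = phiO C A"
      using Fn.FObj_closed[OF A] Fn.phiO_F[OF A] by auto
    have cart: "cartesian_arrow B Rs (\<eta> A) ?E ?u"
      using Rs.choice_cartesian[of ?E "\<eta> A"] Fs.FObj_closed[OF \<alpha>A] Fs.phiO_F[OF \<alpha>A] \<eta>A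
      by (auto simp: Hom_def)
    note image = R.cartesian_arrow_image[OF cart]
    have id: "Idn B (phiO C A) \<in> Hom B (phiO C A) (phiO C A)"
      using Rs.cod.Idn_Hom Rs.cod.Hom_Obj[OF \<eta>A] by blast
    \<comment> \<open>Places the identity supplied by soundness at the codomain of
      \<open>\<eta> A\<close>, so that the two can be composed.\<close>
    have "phiO Rn (FObj Fn (FObj \<gamma>D (\<alpha> A))) = phiO D (\<alpha> A)"
      using Fn.phiO_F[OF W.FObj_closed[OF \<alpha>A]] W.phiO_F[OF \<alpha>A] by simp
    then have "forces Rn (FObj Fn (FObj \<gamma>D (\<alpha> A))) (Idn B (phiO D (\<alpha> A))) (FObj \<gamma>R ?E)"
      using \<open>sound B D Rn \<gamma>R Fs (functor_comp Fn \<gamma>D)\<close> \<alpha>A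
      by (auto simp: sound_def preceq_def functor_comp_def)
    then have "forces Rn (FObj Fn A) (Cmp B (Idn B (phiO D (\<alpha> A))) (\<eta> A)) (FObj \<gamma>R ?E)"
      by (rule Fn.tgt.forces_Cmp[OF Fn.forces_image[OF W.unit[OF A]]])
    \<comment> \<open>Both composites equal \<open>\<eta> A\<close>; with the identity on the right,
      the arrow has the form to which the universal property of a cartesian arrow over
      \<open>\<eta> A\<close> applies.\<close>
    then have "forces Rn (FObj Fn A) (Cmp B (\<eta> A) (Idn B (phiO C A))) (FObj \<gamma>R ?E)"
      using Rs.cod.Cmp_Idn_left[OF \<eta>A] Rs.cod.Cmp_Idn_right[OF \<eta>A] by simp
    moreover have "Dom B (\<eta> A) = phiO C A"
      using \<eta>A by (simp add: Hom_def)
    \<comment> \<open>The universal property is used with \<open>Z\<close> as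
      \<open>FObj Fn A\<close> and \<open>h\<close> as the identity; \<open>image(2)\<close>
      identifies the domain it yields with \<open>\<gamma>R\<close> of the inverse image.\<close>
    ultimately show ?thesis
      using image FnA id
      by (auto simp: cartesian_arrow_def preceq_def inverse_image_def)
  qed
  then show ?thesis
    by (simp add: sound_def FObj_lifting)
qed

end
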